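(* No fractional online algorithm achieves a competitive ratio better than $0.75$ for the unweighted fractional online stochastic matching problem (with independent, not necessarily identically distributed, arrivals).
   Context: Problem: offline vertex set $L$ (unweighted, i.e. all weights $1$); online vertices $v_1,\dots,v_n$ arrive in a fixed order, the type $t_j$ of $v_j$ (which specifies its set of offline neighbours) being drawn independently from a known distribution $D_j$. On arrival of $v_j$, after seeing $t_1,\dots,t_j$, a fractional online algorithm irrevocably chooses $x_{u,j}\ge0$ for $u\in L$, positive only for neighbours $u$ of $v_j$, with $\sum_u x_{u,j}\le1$; its value is $\sum_{u}\min(\sum_j x_{u,j},1)$. Its competitive ratio is the infimum over instances of the expected value divided by the expected size of a maximum matching of the realized graph. *)

theory Defs
  imports "HOL-Probability.Probability"
begin

text \<open>Online vertices are indexed by \<open>1, \<dots>, arrivals I\<close> in arrival order. Offline vertices and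
  types are named by natural numbers; the distributions are discrete, and a type matters to the
  problem only through its (finite) set of offline neighbours.\<close>

record osm_instance =
  offline :: "nat set"
  arrivals :: nat
  nbrs :: "nat \<Rightarrow> nat set"
  type_dist :: "nat \<Rightarrow> nat pmf"

definition osm_instance :: "osm_instance \<Rightarrow> bool" where
  "osm_instance I \<longleftrightarrow> finite (offline I) \<and> (\<forall>t. nbrs I t \<subseteq> offline I)"

text \<open>The independent draw of the types \<open>t 1, \<dots>, t n\<close>; outside \<open>{1..n}\<close> the type
  profile takes the irrelevant default value \<open>0\<close>.\<close>

definition type_profiles :: "osm_instance \<Rightarrow> (nat \<Rightarrow> nat) pmf" where
  "type_profiles I = Pi_pmf {1..arrivals I} 0 (type_dist I)"

definition realized_edges :: "osm_instance \<Rightarrow> (nat \<Rightarrow> nat) \<Rightarrow> (nat \<times> nat) set" where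
  "realized_edges I t = {(u, j). j \<in> {1..arrivals I} \<and> u \<in> nbrs I (t j)}"

definition matching :: "(nat \<times> nat) set \<Rightarrow> (nat \<times> nat) set \<Rightarrow> bool" where
  "matching E M \<longleftrightarrow> M \<subseteq> E \<and> inj_on fst M \<and> inj_on snd M"

definition max_matching_size :: "(nat \<times> nat) set \<Rightarrow> nat" where
  "max_matching_size E = Max (card ` {M. matching E M})"

definition expected_opt :: "osm_instance \<Rightarrow> real" where
  "expected_opt I =
     measure_pmf.expectation (type_profiles I) (\<lambda>t. real (max_matching_size (realized_edges I t)))"

text \<open>On a fixed instance, a policy maps the observed history \<open>[t 1, \<dots>, t j]\<close> and an offline
  vertex \<open>u\<close> to the amount \<open>x\<^sub>u\<^sub>,\<^sub>j\<close>; later types are not available to it. An algorithm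
  chooses the policy knowing the whole instance, in particular all the distributions.\<close>

type_synonym policy = "nat list \<Rightarrow> nat \<Rightarrow> real"

type_synonym algorithm = "osm_instance \<Rightarrow> policy"

definition allocation :: "policy \<Rightarrow> (nat \<Rightarrow> nat) \<Rightarrow> nat \<Rightarrow> nat \<Rightarrow> real" where
  "allocation p t u j = p (map t [1..<Suc j]) u"

definition feasible_policy :: "osm_instance \<Rightarrow> policy \<Rightarrow> bool" where
  "feasible_policy I p \<longleftrightarrow>
     (\<forall>t \<in> set_pmf (type_profiles I). \<forall>j \<in> {1..arrivals I}.
        (\<forall>u \<in> offline I. allocation p t u j \<ge> 0) \<and>
        (\<forall>u \<in> offline I. allocation p t u j > 0 \<longrightarrow> u \<in> nbrs I (t j)) \<and>
        (\<Sum>u \<in> offline I. allocation p t u j) \<le> 1)"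

definition fractional_online_algorithm :: "algorithm \<Rightarrow> bool" where
  "fractional_online_algorithm A \<longleftrightarrow> (\<forall>I. osm_instance I \<longrightarrow> feasible_policy I (A I))"

definition policy_value :: "osm_instance \<Rightarrow> policy \<Rightarrow> (nat \<Rightarrow> nat) \<Rightarrow> real" where
  "policy_value I p t = (\<Sum>u \<in> offline I. min (\<Sum>j = 1..arrivals I. allocation p t u j) 1)"

definition expected_value :: "osm_instance \<Rightarrow> policy \<Rightarrow> real" where
  "expected_value I p = measure_pmf.expectation (type_profiles I) (policy_value I p)"

text \<open>Instances with expected optimum \<open>0\<close> are left out: the ratio is meaningless there, and
  division by zero would make the infimum \<open>0\<close>.\<close>

definition competitive_ratio :: "algorithm \<Rightarrow> real" where
  "competitive_ratio A =
     Inf {expected_value I (A I) / expected_opt I | I. osm_instance I \<and> expected_opt I > 0}"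

end

theory Submission
  imports Defs
begin

text \<open>The hard instance has two offline vertices \<open>0\<close>, \<open>1\<close>. The first arrival sees both of them; the
  second one sees a single vertex, chosen by a fair coin. A perfect matching always exists, but
  whatever the first arrival puts on the vertex that the second one turns out to see is lost, and
  the two possible losses average to \<open>1/2\<close>.\<close>

lemma expected_value_nonneg:
  assumes "feasible_policy I p"
  shows "expected_value I p \<ge> 0"
  unfolding expected_value_def
proof (rule integral_nonneg_AE, rule AE_pmfI)
  fix t assume "t \<in> set_pmf (type_profiles I)"
  with assms show "0 \<le> policy_value I p t"
    unfolding feasible_policy_def policy_value_def by (intro sum_nonneg) (auto intro!: sum_nonneg)
qed

lemma competitive_ratio_le:
  assumes "fractional_online_algorithm A" and "osm_instance I" and "expected_opt I > 0"
  shows "competitive_ratio A \<le> expected_value I (A I) / expected_opt I"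
  unfolding competitive_ratio_def
proof (rule cInf_lower)
  \<comment> \<open>On the reals \<open>Inf\<close> is a lower bound only of sets bounded below;
    since allocations are nonnegative, \<open>0\<close> bounds all ratios.\<close>
  show "bdd_below {expected_value I (A I) / expected_opt I | I. osm_instance I \<and> expected_opt I > 0}"
    using assms(1) expected_value_nonneg
    by (intro bdd_belowI[of _ 0]) (force simp: fractional_online_algorithm_def)
qed (use assms in blast)

text \<open>Types \<open>0\<close> and \<open>1\<close> are named after the one vertex they see, so
  the type of the second arrival is also its neighbour.\<close>

definition coin_instance :: osm_instance where
  "coin_instance = \<lparr>offline = {0, 1}, arrivals = 2,
     nbrs = (\<lambda>t. if t < 2 then {t} else {0, 1}),
     type_dist = (\<lambda>j. if j = 1 then return_pmf 2 else pmf_of_set {0, 1})\<rparr>"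

definition coin_profile :: "nat \<Rightarrow> nat \<Rightarrow> nat" where
  "coin_profile b = (\<lambda>_. 0)(1 := 2, 2 := b)"

lemma osm_instance_coin: "osm_instance coin_instance"
  by (auto simp: osm_instance_def coin_instance_def)

lemma atLeastAtMost_1_2: "{Suc 0..2} = {Suc 0, 2}"
  by auto

lemma type_profiles_coin:
  "type_profiles coin_instance = map_pmf coin_profile (pmf_of_set {0, 1})"
proof -
  have "type_profiles coin_instance = Pi_pmf {1, 2} 0 (type_dist coin_instance)"
    by (simp add: type_profiles_def coin_instance_def atLeastAtMost_1_2)
  \<comment> \<open>Splitting off arrival 2 makes its update the outer one, the order used in
    \<open>coin_profile\<close>.\<close>
  also have "{1, 2} = insert 2 {1::nat}"
    by auto
  finally show ?thesis
    by (simp add: Pi_pmf_insert' Pi_pmf_singleton coin_instance_def map_pmf_def bind_assoc_pmf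
        bind_return_pmf coin_profile_def[abs_def] fun_upd_def)
qed

lemma expectation_coin:
  "measure_pmf.expectation (type_profiles coin_instance) f =
     (f (coin_profile 0) + f (coin_profile 1)) / 2" for f :: "_ \<Rightarrow> real"
  by (simp add: type_profiles_coin integral_pmf_of_set)

lemma max_matching_size_ge:
  assumes "finite E" and "matching E M"
  shows "max_matching_size E \<ge> card M"
proof -
  have "{M. matching E M} \<subseteq> Pow E"
    by (auto simp: matching_def)
  with assms show ?thesis
    unfolding max_matching_size_def by (auto intro!: Max_ge intro: finite_subset)
qed

lemma max_matching_size_coin:
  assumes "b < 2"
  shows "max_matching_size (realized_edges coin_instance (coin_profile b)) \<ge> 2"
proof -
  let ?E = "realized_edges coin_instance (coin_profile b)"
  have "?E \<subseteq> {0, 1} \<times> {1, 2}"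
    by (auto simp: realized_edges_def coin_instance_def split: if_splits)
  hence "finite ?E"
    by (rule finite_subset) auto
  \<comment> \<open>In hindsight the first arrival takes \<open>1 - b\<close>, which the second one
    cannot see.\<close>
  moreover have "matching ?E {(1 - b, 1), (b, 2)}"
    using assms
    by (auto simp: matching_def realized_edges_def coin_instance_def coin_profile_def
        less_2_cases_iff)
  ultimately have "card {(1 - b, 1), (b, 2::nat)} \<le> max_matching_size ?E"
    by (rule max_matching_size_ge)
  thus ?thesis by simp
qed

lemma expected_opt_coin: "expected_opt coin_instance \<ge> 2"
  using max_matching_size_coin[of 0] max_matching_size_coin[of 1]
  by (simp add: expected_opt_def expectation_coin)

text \<open>Vertex \<open>b\<close> counts at most 1 by the cap, and \<open>1 - b\<close> receives
  nothing after the first arrival. The history \<open>[2]\<close> at that point does not depend on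
  \<open>b\<close>: the policy commits before the coin is tossed.\<close>

lemma policy_value_coin:
  assumes "feasible_policy coin_instance p" and "b < 2"
  shows "policy_value coin_instance p (coin_profile b) \<le> 1 + p [2] (1 - b)"
proof -
  let ?x = "allocation p (coin_profile b)"
  have "coin_profile b \<in> set_pmf (type_profiles coin_instance)"
    using assms(2) by (auto simp: type_profiles_coin less_2_cases_iff)
  moreover have "1 - b \<in> offline coin_instance" "2 \<in> {1..arrivals coin_instance}"
    by (auto simp: coin_instance_def)
  moreover have "1 - b \<notin> nbrs coin_instance (coin_profile b 2)"
    using assms(2) by (auto simp: coin_instance_def coin_profile_def less_2_cases_iff)
  ultimately have "\<not> ?x (1 - b) 2 > 0"
    using assms(1) unfolding feasible_policy_def by blast
  hence "?x (1 - b) 2 \<le> 0"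
    by simp
  moreover have "?x (1 - b) 1 = p [2] (1 - b)"
    by (simp add: allocation_def coin_profile_def)
  moreover have "policy_value coin_instance p (coin_profile b) =
      min (?x b 1 + ?x b 2) 1 + min (?x (1 - b) 1 + ?x (1 - b) 2) 1"
    using assms(2)
    by (auto simp: policy_value_def coin_instance_def atLeastAtMost_1_2 less_2_cases_iff)
  ultimately show ?thesis by linarith
qed

lemma first_arrival_coin:
  assumes "feasible_policy coin_instance p"
  shows "p [2] 0 + p [2] 1 \<le> 1"
proof -
  have "coin_profile 0 \<in> set_pmf (type_profiles coin_instance)"
    by (auto simp: type_profiles_coin)
  hence "(\<Sum>u \<in> offline coin_instance. allocation p (coin_profile 0) u 1) \<le> 1"
    using assms unfolding feasible_policy_def by (force simp: coin_instance_def)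
  thus ?thesis
    by (simp add: allocation_def coin_instance_def coin_profile_def)
qed

text \<open>Averaging the bounds for the two outcomes gives
  \<open>1 + (p [2] 0 + p [2] 1) / 2\<close>, and the first arrival distributes at most one
  unit.\<close>

lemma expected_value_coin:
  assumes "feasible_policy coin_instance p"
  shows "expected_value coin_instance p \<le> 3 / 2"
  using policy_value_coin[OF assms, of 0] policy_value_coin[OF assms, of 1]
    first_arrival_coin[OF assms]
  by (simp add: expected_value_def expectation_coin)

theorem theorem5:
  fixes A :: algorithm
  assumes "fractional_online_algorithm A"
  shows "competitive_ratio A \<le> 3 / 4"
proof -
  have feasible: "feasible_policy coin_instance (A coin_instance)"
    using assms osm_instance_coin by (simp add: fractional_online_algorithm_def)
  have "competitive_ratio A \<le>
      expected_value coin_instance (A coin_instance) / expected_opt coin_instance"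
    using assms osm_instance_coin expected_opt_coin by (intro competitive_ratio_le) auto
  also have "\<dots> \<le> (3 / 2) / 2"
    using expected_value_coin[OF feasible] expected_value_nonneg[OF feasible] expected_opt_coin
    by (intro frac_le) auto
  finally show ?thesis by simp
qed

end
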